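(* For every $n\ge2$, the crown graph $K_{n,n}-M$ is an exact $k$-leaf power for every integer $k\ge5$. In particular, the cube $Q_3\cong K_{4,4}-M$ is an exact $5$-leaf power.
   Context: Graphs are finite, simple, undirected. A graph $G$ is an exact $k$-leaf power if there is a tree $T$ whose leaf set is $V(G)$ such that for distinct $u,v\in V(G)$, $uv\in E(G)$ if and only if $\operatorname{dist}_T(u,v)=k$. Here $K_{n,n}-M$ denotes the complete bipartite graph $K_{n,n}$ with the edges of a perfect matching $M$ removed, and $Q_3$ is the $3$-dimensional cube graph. *)

theory Defs
  imports "Graph_Theory.Graph_Theory"
begin

text \<open>
  A finite simple graph is a \<open>pair_graph\<close>: a finite loop-free digraph whose arc relation is
  symmetric, so that an undirected edge is represented by its two opposite arcs.
\<close>

text \<open>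
  The constants \<open>forest\<close> and \<open>tree\<close> of the imported library cannot be used here: in a symmetric
  digraph they count the walk \<open>u, v, u\<close> along a single edge as a cycle. The undirected cycles are
  exactly the library cycles with at least three arcs. (\<open>connected\<close> includes nonemptiness.)
\<close>
definition undirected_tree :: "'a pair_pre_digraph \<Rightarrow> bool" where
  "undirected_tree T \<longleftrightarrow> pair_graph T \<and> connected (with_proj T) \<and>
     (\<nexists>p. pre_digraph.cycle (with_proj T) p \<and> length p \<ge> 3)"

definition leaves :: "'a pair_pre_digraph \<Rightarrow> 'a set" where
  "leaves T = {v \<in> pverts T. out_degree (with_proj T) v = 1}"

text \<open>The shortest-path cost \<open>\<mu>\<close> for unit weights; it is \<open>\<infinity>\<close> between different components.\<close>
definition graph_dist :: "'a pair_pre_digraph \<Rightarrow> 'a \<Rightarrow> 'a \<Rightarrow> ereal" where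
  "graph_dist G u v = wf_digraph.\<mu> (with_proj G) (\<lambda>_. 1) u v"

text \<open>
  The vertex type of the tree is \<open>'a + nat\<close>, with \<open>Inl v\<close> playing the role of the vertex \<open>v\<close> of \<open>G\<close>,
  so that an unlimited supply of further vertices is available for the inner nodes of the
  (finite) tree even if \<open>'a\<close> is a finite type.
\<close>
definition exact_leaf_power :: "nat \<Rightarrow> 'a pair_pre_digraph \<Rightarrow> bool" where
  "exact_leaf_power k G \<longleftrightarrow> pair_graph G \<and>
     (\<exists>T :: ('a + nat) pair_pre_digraph. undirected_tree T \<and> leaves T = Inl ` pverts G \<and>
        (\<forall>u \<in> pverts G. \<forall>v \<in> pverts G. u \<noteq> v \<longrightarrow>
           ((u, v) \<in> parcs G \<longleftrightarrow> graph_dist T (Inl u) (Inl v) = ereal (real k))))"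

text \<open>A matching is a set of edges, hence a symmetric set of arcs.\<close>
definition perfect_matching :: "'a pair_pre_digraph \<Rightarrow> 'a rel \<Rightarrow> bool" where
  "perfect_matching G M \<longleftrightarrow> M \<subseteq> parcs G \<and> sym M \<and> (\<forall>v \<in> pverts G. \<exists>!w. (v, w) \<in> M)"

text \<open>\<open>crown_graph n C\<close>: the graph \<open>C\<close> is \<open>K\<^sub>n\<^sub>,\<^sub>n\<close> minus some perfect matching.\<close>
definition crown_graph :: "nat \<Rightarrow> 'a pair_pre_digraph \<Rightarrow> bool" where
  "crown_graph n C \<longleftrightarrow> (\<exists>K M. complete_bipartite_digraph n n (with_proj K) \<and>
     perfect_matching K M \<and> C = K\<lparr>parcs := parcs K - M\<rparr>)"

lemma crown_graph_exists: "\<exists>C :: (nat + nat) pair_pre_digraph. crown_graph n C"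
proof -
  let ?U = "Inl ` {..<n} :: (nat + nat) set" and ?V = "Inr ` {..<n} :: (nat + nat) set"
  let ?K = "\<lparr>pverts = ?U \<union> ?V, parcs = ?U \<times> ?V \<union> ?V \<times> ?U\<rparr>"
  let ?M = "(\<Union>i<n. {(Inl i, Inr i), (Inr i, Inl i)}) :: (nat + nat) rel"
  have "complete_bipartite_digraph n n (with_proj ?K)"
    unfolding complete_bipartite_digraph_pair_def
    by (intro conjI exI[of _ ?U] exI[of _ ?V]) (auto simp: card_image)
  moreover have "perfect_matching ?K ?M"
    unfolding perfect_matching_def by (auto simp: sym_def)
  ultimately show ?thesis
    unfolding crown_graph_def by blast
qed

definition hypercube :: "nat \<Rightarrow> bool list pair_pre_digraph" where
  "hypercube d = \<lparr>pverts = {xs. length xs = d},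
     parcs = {(xs, ys). length xs = d \<and> length ys = d \<and> card {i. i < d \<and> xs ! i \<noteq> ys ! i} = 1}\<rparr>"

end

theory Submission
  imports Defs
begin

text \<open>
  The tree realising the crown graph with sides \<open>u\<^sub>0, \<dots>, u\<^sub>n\<^sub>-\<^sub>1\<close> and \<open>v\<^sub>0, \<dots>, v\<^sub>n\<^sub>-\<^sub>1\<close> is a spider-like
  tree with one branch per matched (hence nonadjacent) pair \<open>u\<^sub>i, v\<^sub>i\<close>. Branch \<open>i\<close> is a path of length
  \<open>k - 2\<close> from \<open>u\<^sub>i\<close> to \<open>v\<^sub>i\<close> whose second vertex \<open>w\<^sub>i\<close> is joined to a common centre. Then \<open>u\<^sub>i\<close> has depth
  \<open>2\<close> and \<open>v\<^sub>i\<close> has depth \<open>k - 2\<close>, so that leaves of different branches are at distance \<open>k\<close> if they lie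
  on opposite sides, and at distance \<open>4\<close> or \<open>2 * (k - 2)\<close> if they lie on the same side. The last two
  numbers differ from \<open>k\<close> because \<open>k > 4\<close>. The path between \<open>u\<^sub>i\<close> and \<open>v\<^sub>i\<close> bypasses the centre, which
  is why this pair is at distance \<open>k - 2\<close> only. At least two branches are needed for the centre not
  to be a leaf.

  Distances in the spider have a simple closed form, so the tree is introduced through its distance
  function: the locale \<open>tree_metric\<close> collects elementary conditions on a function
  \<open>\<delta>\<close> under which the graph of all pairs with \<open>\<delta> x y = 1\<close> is a tree with distance \<open>\<delta>\<close>
  (\<open>undirected_tree_unit_graph\<close>, \<open>graph_dist_unit_graph\<close>). Lemma \<open>exact_leaf_powerI\<close> turns such a
  function into a proof that a graph is an exact leaf power, \<open>tree_metric_spider\<close> and \<open>spider_leaves\<close>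
  supply the spider, and \<open>crown_exact_leaf_power\<close> reads off the adjacencies.

  For the cube, the sides are the even and the odd vectors. An even and an odd vector differ
  in one or in three coordinates, and in three only if they are antipodal; so the cube is
  \<open>K\<^sub>4\<^sub>,\<^sub>4\<close> without the antipodal matching.
\<close>

section \<open>Trees given by their distance function\<close>

lemma card_Collect_eq_1_iff: "card {y. P y} = 1 \<longleftrightarrow> (\<exists>!y. P y)"
  unfolding One_nat_def card_1_singleton_iff set_eq_iff by auto

text \<open>
  The conditions speak about single steps only, so that they can be checked by a case
  distinction: \<open>dist_step\<close> bounds the length of walks from below, \<open>first_step\<close> builds shortest walks,
  and \<open>unique_parent\<close> excludes cycles, as no vertex has two neighbours that are at most as far from
  the root \<open>r\<close> as it is itself.
\<close>
locale tree_metric =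
  fixes V :: "'c set" and \<delta> :: "'c \<Rightarrow> 'c \<Rightarrow> nat" and r :: 'c
  assumes finite_V: "finite V"
    and root_in_V: "r \<in> V"
    and dist_0_iff: "\<And>x y. x \<in> V \<Longrightarrow> y \<in> V \<Longrightarrow> \<delta> x y = 0 \<longleftrightarrow> x = y"
    and dist_commute: "\<And>x y. x \<in> V \<Longrightarrow> y \<in> V \<Longrightarrow> \<delta> x y = \<delta> y x"
    and dist_step: "\<And>x y z. x \<in> V \<Longrightarrow> y \<in> V \<Longrightarrow> z \<in> V \<Longrightarrow> \<delta> x z = 1 \<Longrightarrow> \<delta> x y \<le> \<delta> z y + 1"
    and first_step: "\<And>x y. x \<in> V \<Longrightarrow> y \<in> V \<Longrightarrow> x \<noteq> y \<Longrightarrow>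
      \<exists>z\<in>V. \<delta> x z = 1 \<and> \<delta> z y + 1 = \<delta> x y"
    and unique_parent: "\<And>x y z. x \<in> V \<Longrightarrow> y \<in> V \<Longrightarrow> z \<in> V \<Longrightarrow> \<delta> x y = 1 \<Longrightarrow> \<delta> x z = 1 \<Longrightarrow>
      \<delta> r y \<le> \<delta> r x \<Longrightarrow> \<delta> r z \<le> \<delta> r x \<Longrightarrow> y = z"
begin

definition unit_graph :: "'c pair_pre_digraph" where
  "unit_graph = \<lparr>pverts = V, parcs = {(x, y). x \<in> V \<and> y \<in> V \<and> \<delta> x y = 1}\<rparr>"

lemma unit_graph_simps [simp]:
  "pverts unit_graph = V"
  "(x, y) \<in> parcs unit_graph \<longleftrightarrow> x \<in> V \<and> y \<in> V \<and> \<delta> x y = 1"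
  by (simp_all add: unit_graph_def)

lemma pair_graph_unit_graph: "pair_graph unit_graph"
proof
  have "parcs unit_graph \<subseteq> V \<times> V" by auto
  then show "finite (parcs unit_graph)"
    using finite_V by (meson finite_SigmaI finite_subset)
  show "symmetric (with_proj unit_graph)"
    unfolding symmetric_def by (auto intro!: symI simp: dist_commute)
  show "fst e \<noteq> snd e" if "e \<in> parcs unit_graph" for e
  proof -
    have "fst e \<in> V" "\<delta> (fst e) (snd e) = 1"
      using that unit_graph_simps(2)[of "fst e" "snd e"] by simp_all
    then show ?thesis using dist_0_iff[of "fst e" "fst e"] by auto
  qed
qed (auto simp: finite_V unit_graph_def)

sublocale T: pair_graph unit_graph
  by (rule pair_graph_unit_graph)

text \<open>Following \<open>first_step\<close> decreases the remaining distance by one in each step.\<close>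
lemma walk_of_length_dist:
  assumes "x \<in> V" "y \<in> V"
  shows "\<exists>p. T.awalk x p y \<and> length p = \<delta> x y"
  using assms
proof (induction "\<delta> x y" arbitrary: x)
  case 0
  then have "x = y" using dist_0_iff by simp
  then show ?case using 0 by (intro exI[of _ "[]"]) (simp add: T.awalk_Nil_iff)
next
  case (Suc d)
  then have "x \<noteq> y" using dist_0_iff[of x y] by auto
  then obtain z where z: "z \<in> V" "\<delta> x z = 1" "\<delta> z y + 1 = \<delta> x y"
    using first_step Suc.prems by blast
  then have "d = \<delta> z y" using Suc.hyps(2) by simp
  then obtain p where "T.awalk z p y" "length p = \<delta> z y"
    using Suc.hyps(1) z(1) Suc.prems(2) by blast
  then show ?case
    using z Suc.prems by (intro exI[of _ "(x, z) # p"]) (simp add: T.awalk_Cons_iff)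
qed

text \<open>By \<open>dist_step\<close>, one arc of a walk shortens the distance to its end by at most one.\<close>
lemma dist_le_walk_length:
  assumes "T.awalk x p y"
  shows "\<delta> x y \<le> length p"
  using assms
proof (induction p arbitrary: x)
  case Nil
  then show ?case using dist_0_iff[of y y] by (auto simp: T.awalk_Nil_iff)
next
  case (Cons e p)
  obtain a z where e: "e = (a, z)" by force
  with Cons.prems have *: "a = x" "x \<in> V" "z \<in> V" "\<delta> x z = 1" "T.awalk z p y"
    by (auto simp: T.awalk_Cons_iff)
  then have "y \<in> V" using T.awalk_last_in_verts by simp
  then have "\<delta> x y \<le> \<delta> z y + 1" using * dist_step by blast
  then show ?case using Cons.IH[OF *(5)] by simp
qed

lemma graph_dist_unit_graph:
  assumes "x \<in> V" "y \<in> V"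
  shows "graph_dist unit_graph x y = ereal (real (\<delta> x y))"
proof -
  have cost: "T.awalk_cost (\<lambda>_. 1) p = real (length p)" for p
    by (induction p) simp_all
  show ?thesis
    unfolding graph_dist_def T.\<mu>_def cost
  proof (rule antisym)
    obtain p where "T.awalk x p y" "length p = \<delta> x y"
      using walk_of_length_dist assms by blast
    then show "(INF p\<in>{p. T.awalk x p y}. ereal (real (length p))) \<le> ereal (real (\<delta> x y))"
      by (intro INF_lower2[of p]) auto
    show "ereal (real (\<delta> x y)) \<le> (INF p\<in>{p. T.awalk x p y}. ereal (real (length p)))"
      by (intro INF_greatest) (simp add: dist_le_walk_length)
  qed
qed

lemma connected_unit_graph: "connected (with_proj unit_graph)"
  unfolding connected_def
proof
  show "verts (mk_symmetric (with_proj unit_graph)) \<noteq> {}" using root_in_V by auto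
next
  fix x y
  assume "x \<in> verts (mk_symmetric (with_proj unit_graph))" "y \<in> verts (mk_symmetric (with_proj unit_graph))"
  then have "x \<rightarrow>\<^sup>*\<^bsub>with_proj unit_graph\<^esub> y"
    using walk_of_length_dist by (auto intro: T.reachable_awalkI)
  then show "x \<rightarrow>\<^sup>*\<^bsub>mk_symmetric (with_proj unit_graph)\<^esub> y"
    using T.reachable_mk_symmetric_eq[OF T.sym_arcs] by simp
qed

lemma consecutive_arcs:
  assumes "T.awalk x p y" "Suc i < length p"
  shows "fst (p ! Suc i) = snd (p ! i)"
  using assms
proof (induction p arbitrary: x i)
  case (Cons e p)
  then show ?case by (cases i; cases p) (auto simp: T.awalk_Cons_iff)
qed simp

text \<open>
  Both neighbours that the deepest vertex of a cycle has on the cycle are at most as deep as it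
  is, so they coincide by \<open>unique_parent\<close>. This is impossible for a cycle with three or more vertices.
\<close>
lemma no_long_cycle:
  assumes "T.cycle p"
  shows "length p < 3"
proof (rule ccontr)
  assume "\<not> length p < 3"
  then have len: "3 \<le> length p" by simp
  let ?n = "length p"
  obtain x where walk: "T.awalk x p x" and dist: "distinct (tl (pawalk_verts x p))" and ne: "p \<noteq> []"
    using assms by (auto simp: T.cycle_def)
  have "tl (pawalk_verts x p) = map snd p"
    using T.awalk_verts_conv'[of x p x] walk ne by (auto simp: T.awalk_def)
  then have dist: "distinct (map snd p)" using dist by simp
  have next_arc: "fst (p ! (Suc i mod ?n)) = snd (p ! i)" if "i < ?n" for i
  proof (cases "Suc i < ?n")
    case True
    then show ?thesis using consecutive_arcs[OF walk] by simp
  next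
    case False
    then have i: "Suc i = ?n" using that by simp
    then have "snd (p ! i) = snd (last p)" using ne by (simp add: last_conv_nth flip: i)
    also have "\<dots> = x"
      using walk ne by (induction p rule: rev_induct) (auto simp: T.awalk_def T.cas_append_iff)
    also have "\<dots> = fst (p ! 0)" using walk ne by (cases p) (auto simp: T.awalk_Cons_iff)
    finally show ?thesis using i by simp
  qed
  have arc: "fst (p ! i) \<in> V" "snd (p ! i) \<in> V" "\<delta> (fst (p ! i)) (snd (p ! i)) = 1" if "i < ?n" for i
  proof -
    have "p ! i \<in> parcs unit_graph" using walk that by (auto simp: T.awalk_def)
    then show "fst (p ! i) \<in> V" "snd (p ! i) \<in> V" "\<delta> (fst (p ! i)) (snd (p ! i)) = 1"
      using unit_graph_simps(2)[of "fst (p ! i)" "snd (p ! i)"] by simp_all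
  qed
  (* The deepest vertex is the head of arc m; its neighbours on the cycle are the head of the
     preceding arc a and the head of the following arc b. *)
  let ?D = "\<lambda>i. \<delta> r (snd (p ! i))"
  obtain m where m: "m < ?n" and max: "\<And>i. i < ?n \<Longrightarrow> ?D i \<le> ?D m"
  proof -
    have "Max (?D ` {..<?n}) \<in> ?D ` {..<?n}" using ne by (intro Max_in) auto
    then obtain m where "m < ?n" "Max (?D ` {..<?n}) = ?D m" by auto
    then show ?thesis using that[of m] by (metis Max_ge finite_imageI finite_lessThan imageI lessThan_iff)
  qed
  define a where "a = (if m = 0 then ?n - 1 else m - 1)"
  define b where "b = Suc m mod ?n"
  have "0 < ?n" using len by linarith
  then have ab: "a < ?n" "b < ?n" using m by (auto simp: a_def b_def)
  have "Suc a mod ?n = m" using m by (auto simp: a_def)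
  then have a_m: "snd (p ! a) = fst (p ! m)" using next_arc[OF ab(1)] by simp
  have b_m: "fst (p ! b) = snd (p ! m)" using next_arc[OF m] by (simp add: b_def)
  have "snd (p ! a) = snd (p ! b)"
  proof (rule unique_parent[of "snd (p ! m)"])
    show "\<delta> (snd (p ! m)) (snd (p ! a)) = 1" using arc[OF m] a_m dist_commute by simp
    show "\<delta> (snd (p ! m)) (snd (p ! b)) = 1" using arc(3)[OF ab(2)] b_m by simp
  qed (use arc m ab max in auto)
  then have "a = b" using dist ab by (auto simp: distinct_map dest: inj_onD simp: nth_eq_iff_index_eq)
  then show False using m len
    by (cases "Suc m = ?n") (auto simp: a_def b_def split: if_splits)
qed

lemma undirected_tree_unit_graph: "undirected_tree unit_graph"
  unfolding undirected_tree_def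
  using pair_graph_unit_graph connected_unit_graph no_long_cycle by force

lemma leaves_unit_graph: "leaves unit_graph = {x \<in> V. \<exists>!y. y \<in> V \<and> \<delta> x y = 1}"
proof -
  have "out_degree (with_proj unit_graph) x = 1 \<longleftrightarrow> (\<exists>!y. y \<in> V \<and> \<delta> x y = 1)" if "x \<in> V" for x
  proof -
    have "out_arcs (with_proj unit_graph) x = Pair x ` {y. y \<in> V \<and> \<delta> x y = 1}"
      using that by (auto simp: out_arcs_def)
    then have "out_degree (with_proj unit_graph) x = card {y. y \<in> V \<and> \<delta> x y = 1}"
      by (simp add: out_degree_def card_image inj_on_def)
    then show ?thesis by (simp only: card_Collect_eq_1_iff)
  qed
  then show ?thesis by (auto simp: leaves_def)
qed

text \<open>
  Being a tree metric is invariant under renaming the points. This lets the spider use convenient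
  coordinates although the tree of an exact leaf power has a prescribed vertex type.
\<close>
lemma transport:
  assumes "inj_on e V"
  shows "tree_metric (e ` V) (\<lambda>x y. \<delta> (the_inv_into V e x) (the_inv_into V e y)) (e r)"
proof -
  have [simp]: "the_inv_into V e (e x) = x" if "x \<in> V" for x
    using assms that by (rule the_inv_into_f_f)
  show ?thesis
  proof (unfold_locales, goal_cases)
    case (3 x y) then show ?case using dist_0_iff assms by auto
  next
    case (5 x y z) then show ?case using dist_step by auto
  next
    case (6 x y)
    then obtain a b where ab: "x = e a" "y = e b" "a \<in> V" "b \<in> V" "a \<noteq> b" by auto
    then obtain z where "z \<in> V" "\<delta> a z = 1" "\<delta> z b + 1 = \<delta> a b"
      using first_step by blast
    then show ?case using ab by (intro bexI[of _ "e z"]) auto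
  next
    case (7 x y z)
    then obtain a b c where abc: "x = e a" "y = e b" "z = e c" "a \<in> V" "b \<in> V" "c \<in> V" by auto
    then have "b = c" using 7(4-7) root_in_V by (intro unique_parent[of a]) auto
    then show ?case using abc by simp
  qed (auto simp: finite_V root_in_V dist_commute)
qed

end

text \<open>
  A tree metric may live on any type here: its leaves are renamed to the vertices of \<open>G\<close> by \<open>f\<close>, and
  its inner points, being finite in number, to natural numbers.
\<close>
lemma exact_leaf_powerI:
  fixes G :: "'a pair_pre_digraph"
  assumes "tree_metric P \<delta> r" and G: "pair_graph G"
    and L_def: "L = {x \<in> P. \<exists>!y. y \<in> P \<and> \<delta> x y = 1}"
    and f: "bij_betw f L (pverts G)"
    and adj: "\<And>x y. x \<in> L \<Longrightarrow> y \<in> L \<Longrightarrow> x \<noteq> y \<Longrightarrow> (f x, f y) \<in> parcs G \<longleftrightarrow> \<delta> x y = k"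
  shows "exact_leaf_power k G"
proof -
  interpret tree_metric P \<delta> r by fact
  obtain g :: "_ \<Rightarrow> nat" where g: "inj_on g P"
    using finite_imp_inj_to_nat_seg[OF finite_V] by blast
  define e :: "_ \<Rightarrow> 'a + nat" where "e x = (if x \<in> L then Inl (f x) else Inr (g x))" for x
  have "inj_on f L" and fL: "f ` L = pverts G"
    using f by (auto simp: bij_betw_def)
  then have e: "inj_on e P"
    using g by (auto simp: inj_on_def e_def)
  define \<delta>' where "\<delta>' x y = \<delta> (the_inv_into P e x) (the_inv_into P e y)" for x y
  interpret T: tree_metric "e ` P" \<delta>' "e r"
    unfolding \<delta>'_def using e by (rule transport)
  have \<delta>'[simp]: "\<delta>' (e x) (e y) = \<delta> x y" if "x \<in> P" "y \<in> P" for x y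
    using that by (simp add: \<delta>'_def the_inv_into_f_f[OF e])
  have L: "L \<subseteq> P" by (auto simp: L_def)
  have "card {y. y \<in> e ` P \<and> \<delta>' (e x) y = 1} = card {y. y \<in> P \<and> \<delta> x y = 1}"
    if "x \<in> P" for x
  proof -
    have "{y. y \<in> e ` P \<and> \<delta>' (e x) y = 1} = e ` {y. y \<in> P \<and> \<delta> x y = 1}"
      using that by auto
    moreover have "inj_on e {y. y \<in> P \<and> \<delta> x y = 1}"
      using e by (rule inj_on_subset) auto
    ultimately show ?thesis by (simp add: card_image)
  qed
  then have "{x \<in> e ` P. card {y. y \<in> e ` P \<and> \<delta>' x y = 1} = 1} =
      e ` {x \<in> P. card {y. y \<in> P \<and> \<delta> x y = 1} = 1}"
    by auto
  then have "leaves T.unit_graph = e ` L"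
    unfolding T.leaves_unit_graph L_def card_Collect_eq_1_iff .
  also have "\<dots> = Inl ` pverts G"
    unfolding fL[symmetric] image_image by (rule image_cong) (auto simp: e_def)
  finally have leaves: "leaves T.unit_graph = Inl ` pverts G" .
  have "(u, v) \<in> parcs G \<longleftrightarrow> graph_dist T.unit_graph (Inl u) (Inl v) = ereal (real k)"
    if uv: "u \<in> pverts G" "v \<in> pverts G" "u \<noteq> v" for u v
  proof -
    obtain x y where xy: "x \<in> L" "y \<in> L" "u = f x" "v = f y"
      using uv fL by blast
    then have "Inl u = e x" "Inl v = e y" by (auto simp: e_def)
    then have "graph_dist T.unit_graph (Inl u) (Inl v) = ereal (real (\<delta> x y))"
      using xy L subsetD[OF L] by (subst T.graph_dist_unit_graph) auto
    then show ?thesis using adj[of x y] xy uv by auto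
  qed
  then show ?thesis
    unfolding exact_leaf_power_def using G T.undirected_tree_unit_graph leaves by blast
qed

section \<open>Crown graphs\<close>

text \<open>
  In the labelling of the two sides by \<open>0, \<dots>, n - 1\<close>, the removed matching joins vertices of equal
  index. Both the crown graph of the hypothesis and the cube are brought into this form.
\<close>
definition crown_labelling :: "nat \<Rightarrow> 'a pair_pre_digraph \<Rightarrow> (nat \<Rightarrow> 'a) \<Rightarrow> (nat \<Rightarrow> 'a) \<Rightarrow> bool" where
  "crown_labelling n G u v \<longleftrightarrow> inj_on u {..<n} \<and> inj_on v {..<n} \<and> u ` {..<n} \<inter> v ` {..<n} = {} \<and>
     pverts G = u ` {..<n} \<union> v ` {..<n} \<and>
     (\<forall>x y. (x, y) \<in> parcs G \<longleftrightarrow>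
        (\<exists>i<n. \<exists>j<n. i \<noteq> j \<and> (x = u i \<and> y = v j \<or> x = v j \<and> y = u i)))"

text \<open>
  Any enumeration of one side will do; the other side inherits its indices along the perfect matching,
  which is a bijection between the sides.
\<close>
lemma crown_graph_labelling:
  assumes "crown_graph n C"
  obtains u v where "crown_labelling n C u v"
proof -
  obtain K M where K: "complete_bipartite_digraph n n (with_proj K)"
    and M: "perfect_matching K M" and C: "C = K\<lparr>parcs := parcs K - M\<rparr>"
    using assms by (auto simp: crown_graph_def)
  obtain U W where fin: "finite (pverts K)" and UW: "pverts K = U \<union> W" "U \<inter> W = {}"
    "card U = n" "card W = n" "parcs K = U \<times> W \<union> W \<times> U"
    using K unfolding complete_bipartite_digraph_pair_def by blast
  have M_sub: "M \<subseteq> parcs K" and M_sym: "\<And>x y. (x, y) \<in> M \<Longrightarrow> (y, x) \<in> M"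
    and M_ex: "\<And>x. x \<in> pverts K \<Longrightarrow> \<exists>!y. (x, y) \<in> M"
    using M by (auto simp: perfect_matching_def sym_def)
  define m where "m x = (THE y. (x, y) \<in> M)" for x
  have m: "(x, m x) \<in> M" if "x \<in> pverts K" for x
    unfolding m_def using M_ex[OF that] by (rule theI')
  have m_eq: "y = m x" if "(x, y) \<in> M" "x \<in> pverts K" for x y
    using M_ex[OF that(2)] m[OF that(2)] that(1) by blast
  have m_U: "m x \<in> W" if "x \<in> U" for x
    using m[of x] that M_sub UW by auto
  have m_W: "m y \<in> U \<and> m (m y) = y" if "y \<in> W" for y
  proof -
    have "(y, m y) \<in> M" using m that UW by auto
    moreover from this have "m y \<in> U" using M_sub UW that by auto
    ultimately show ?thesis using m_eq[of "m y" y] M_sym UW by auto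
  qed
  have inj_m: "inj_on m U"
  proof (rule inj_onI)
    fix x y assume xy: "x \<in> U" "y \<in> U" "m x = m y"
    then have "(m x, x) \<in> M" "(m x, y) \<in> M" using m M_sym UW by (metis UnI1)+
    moreover have "m x \<in> pverts K" using m_U xy UW by auto
    ultimately show "x = y" using M_ex by blast
  qed
  have m_img: "m ` U = W" using m_U m_W by force
  have "finite U" using fin UW by simp
  then obtain u where "bij_betw u {0..<card U} U" using ex_bij_betw_nat_finite by blast
  then have u: "bij_betw u {..<n} U" using UW by (simp add: atLeast0LessThan)
  then have uU: "u ` {..<n} = U" and inj_u: "inj_on u {..<n}" by (auto simp: bij_betw_def)
  have "inj_on (m \<circ> u) {..<n}" using inj_u inj_m uU by (simp add: comp_inj_on)
  moreover have "(m \<circ> u) ` {..<n} = W" using uU m_img by (metis image_comp)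
  moreover have "(x, y) \<in> parcs C \<longleftrightarrow>
     (\<exists>i<n. \<exists>j<n. i \<noteq> j \<and> (x = u i \<and> y = (m \<circ> u) j \<or> x = (m \<circ> u) j \<and> y = u i))" for x y
  proof -
    (* Arcs from U to W only; the arcs of C are these and their reversals. *)
    have one: "(a, b) \<in> U \<times> W - M \<longleftrightarrow> (\<exists>i<n. \<exists>j<n. i \<noteq> j \<and> a = u i \<and> b = m (u j))" for a b
    proof
      assume ab: "(a, b) \<in> U \<times> W - M"
      then obtain i j where ij: "i < n" "j < n" "a = u i" "b = m (u j)"
        using uU m_img by blast
      moreover have "i \<noteq> j" using ab m[of a] UW ij by auto
      ultimately show "\<exists>i<n. \<exists>j<n. i \<noteq> j \<and> a = u i \<and> b = m (u j)" by blast
    next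
      assume "\<exists>i<n. \<exists>j<n. i \<noteq> j \<and> a = u i \<and> b = m (u j)"
      then obtain i j where ij: "i < n" "j < n" "i \<noteq> j" "a = u i" "b = m (u j)" by blast
      then have U: "u i \<in> U" "u j \<in> U" "u i \<noteq> u j" using uU inj_u by (auto dest: inj_onD)
      then have "m (u i) \<noteq> m (u j)" using inj_m by (auto dest: inj_onD)
      then have "(u i, m (u j)) \<notin> M" using m_eq[of "u i" "m (u j)"] U UW by auto
      then show "(a, b) \<in> U \<times> W - M" using ij U m_U by auto
    qed
    have "(x, y) \<in> parcs C \<longleftrightarrow> (x, y) \<in> U \<times> W - M \<or> (y, x) \<in> U \<times> W - M"
      using C UW M_sym by auto
    then show ?thesis unfolding one comp_def by blast
  qed
  ultimately have "crown_labelling n C u (m \<circ> u)"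
    unfolding crown_labelling_def using inj_u uU UW C by simp
  then show ?thesis by (rule that)
qed

lemma crown_labelling_pair_graph:
  assumes "crown_labelling n G u v"
  shows "pair_graph G"
proof
  have V: "pverts G = u ` {..<n} \<union> v ` {..<n}" and disj: "u ` {..<n} \<inter> v ` {..<n} = {}"
    and E: "\<And>x y. (x, y) \<in> parcs G \<longleftrightarrow>
        (\<exists>i<n. \<exists>j<n. i \<noteq> j \<and> (x = u i \<and> y = v j \<or> x = v j \<and> y = u i))"
    using assms by (auto simp: crown_labelling_def)
  show "finite (pverts G)" using V by simp
  have sub: "parcs G \<subseteq> pverts G \<times> pverts G" using V E by auto
  then show "finite (parcs G)" using V by (meson finite_SigmaI finite_subset \<open>finite (pverts G)\<close>)
  show "fst e \<in> pverts G" "snd e \<in> pverts G" if "e \<in> parcs G" for e using sub that by auto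
  show "fst e \<noteq> snd e" if "e \<in> parcs G" for e
  proof -
    have "u i \<noteq> v j" if "i < n" "j < n" for i j using disj that by blast
    then show ?thesis using E[of "fst e" "snd e"] that by (cases e) fastforce
  qed
  show "symmetric (with_proj G)"
    unfolding symmetric_def with_proj_simps by (rule symI) (use E in blast)
qed

lemma crown_labelling_iso:
  assumes G: "crown_labelling n G u v" and H: "crown_labelling n H u' v'"
  shows "digraph_iso (with_proj G) (with_proj H)"
proof -
  have u: "inj_on u {..<n}" and v: "inj_on v {..<n}" and uv: "u ` {..<n} \<inter> v ` {..<n} = {}"
    and VG: "pverts G = u ` {..<n} \<union> v ` {..<n}"
    and EG: "\<And>x y. (x, y) \<in> parcs G \<longleftrightarrow>
        (\<exists>i<n. \<exists>j<n. i \<noteq> j \<and> (x = u i \<and> y = v j \<or> x = v j \<and> y = u i))"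
    using G by (auto simp: crown_labelling_def)
  have u': "inj_on u' {..<n}" and v': "inj_on v' {..<n}" and uv': "u' ` {..<n} \<inter> v' ` {..<n} = {}"
    and VH: "pverts H = u' ` {..<n} \<union> v' ` {..<n}"
    and EH: "\<And>x y. (x, y) \<in> parcs H \<longleftrightarrow>
        (\<exists>i<n. \<exists>j<n. i \<noteq> j \<and> (x = u' i \<and> y = v' j \<or> x = v' j \<and> y = u' i))"
    using H by (auto simp: crown_labelling_def)
  define f where "f x = (if x \<in> u ` {..<n} then u' (the_inv_into {..<n} u x)
    else v' (the_inv_into {..<n} v x))" for x
  have fu[simp]: "f (u i) = u' i" and fv[simp]: "f (v i) = v' i" if "i < n" for i
    using that uv by (auto simp: f_def the_inv_into_f_f[OF u] the_inv_into_f_f[OF v])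
  have inj: "inj_on f (pverts G)"
  proof (rule inj_onI)
    have disj: "u' i \<noteq> v' j" "v' j \<noteq> u' i" if "i < n" "j < n" for i j
      using uv' that by blast+
    fix x y assume "x \<in> pverts G" "y \<in> pverts G" "f x = f y"
    then show "x = y"
      unfolding VG by (elim UnE imageE) (auto simp: disj dest: inj_onD[OF u'] inj_onD[OF v'])
  qed
  interpret G: pair_graph G using G by (rule crown_labelling_pair_graph)
  let ?h = "\<lparr>iso_verts = f, iso_arcs = map_prod f f, iso_head = snd, iso_tail = fst\<rparr>"
  have "inj_on (map_prod f f) (parcs G)"
    by (rule inj_on_subset[OF map_prod_inj_on[OF inj inj]]) (auto dest: G.wellformed')
  then have "pre_digraph.digraph_isomorphism (with_proj G) ?h"
    unfolding G.digraph_isomorphism_def using inj by (auto intro: G.wf_digraph_axioms)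
  moreover have "with_proj H = app_iso ?h (with_proj G)"
  proof -
    have "f ` pverts G = pverts H"
      unfolding VG VH image_Un image_image by (intro arg_cong2[where f = "(\<union>)"] image_cong) auto
    moreover have "map_prod f f ` parcs G = parcs H"
    proof
      show "map_prod f f ` parcs G \<subseteq> parcs H"
      proof
        fix e assume "e \<in> map_prod f f ` parcs G"
        then obtain x y where "e = (f x, f y)" "(x, y) \<in> parcs G" by auto
        then obtain i j where "i < n" "j < n" "i \<noteq> j" "e = (u' i, v' j) \<or> e = (v' j, u' i)"
          using EG[of x y] by auto
        then show "e \<in> parcs H" using EH by blast
      qed
      show "parcs H \<subseteq> map_prod f f ` parcs G"
      proof
        fix e assume "e \<in> parcs H"
        moreover obtain x y where e: "e = (x, y)" by force
        ultimately obtain i j where ij: "i < n" "j < n" "i \<noteq> j"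
          and "x = u' i \<and> y = v' j \<or> x = v' j \<and> y = u' i"
          using EH[of x y] by blast
        then have "e = map_prod f f (u i, v j) \<or> e = map_prod f f (v j, u i)"
          using e by auto
        moreover have "(u i, v j) \<in> parcs G" "(v j, u i) \<in> parcs G"
          using EG ij by blast+
        ultimately show "e \<in> map_prod f f ` parcs G" by blast
      qed
    qed
    ultimately show ?thesis by (simp add: app_iso_def with_proj_def)
  qed
  ultimately show ?thesis unfolding digraph_iso_def by blast
qed

section \<open>The spider\<close>

text \<open>
  \<open>None\<close> is the centre, and \<open>Some (i, s)\<close> is the vertex in position \<open>s\<close> of branch \<open>i\<close>: the leaf \<open>u\<^sub>i\<close> for
  \<open>s = 0\<close>, the neighbour \<open>w\<^sub>i\<close> of the centre for \<open>s = 1\<close>, and the leaf \<open>v\<^sub>i\<close> for \<open>s = k - 2\<close>.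
\<close>
definition spider_verts :: "nat \<Rightarrow> nat \<Rightarrow> (nat \<times> nat) option set" where
  "spider_verts n k = insert None (Some ` ({..<n} \<times> {..k - 2}))"

text \<open>The absolute difference, as truncated subtraction leaves one of the summands zero.\<close>
definition line_dist :: "nat \<Rightarrow> nat \<Rightarrow> nat" where
  "line_dist s t = (s - t) + (t - s)"

text \<open>A path to another branch goes through position \<open>1\<close> and the centre.\<close>
fun spider_dist :: "(nat \<times> nat) option \<Rightarrow> (nat \<times> nat) option \<Rightarrow> nat" where
  "spider_dist None None = 0"
| "spider_dist None (Some (i, s)) = line_dist s 1 + 1"
| "spider_dist (Some (i, s)) None = line_dist s 1 + 1"
| "spider_dist (Some (i, s)) (Some (j, t)) =
     (if i = j then line_dist s t else (line_dist s 1 + 1) + (line_dist t 1 + 1))"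

lemma spider_verts_cases:
  assumes "x \<in> spider_verts n k"
  obtains "x = None" | i s where "x = Some (i, s)" "i < n" "s \<le> k - 2"
  using assms by (auto simp: spider_verts_def)

lemma Some_in_spider_verts [simp]: "Some (i, s) \<in> spider_verts n k \<longleftrightarrow> i < n \<and> s \<le> k - 2"
  and None_in_spider_verts [simp]: "None \<in> spider_verts n k"
  by (auto simp: spider_verts_def)

lemma line_dist_eq_1_iff: "line_dist s t = 1 \<longleftrightarrow> t = Suc s \<or> s = Suc t"
  by (auto simp: line_dist_def)

lemma spider_dist_eq_1_iff:
  "spider_dist x y = 1 \<longleftrightarrow>
     (\<exists>i s. x = Some (i, s) \<and> y = Some (i, Suc s)) \<or> (\<exists>i s. y = Some (i, s) \<and> x = Some (i, Suc s)) \<or>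
     (\<exists>i. x = None \<and> y = Some (i, 1)) \<or> (\<exists>i. y = None \<and> x = Some (i, 1))"
proof (cases x; cases y)
  fix p q assume "x = Some p" "y = Some q"
  then show ?thesis
    by (cases p; cases q) (auto simp: line_dist_eq_1_iff[unfolded One_nat_def])
qed (auto simp: line_dist_def)

text \<open>
  The only condition with some content is \<open>first_step\<close>. Seen from branch \<open>i\<close>, a point \<open>y\<close> is entered
  through a position \<open>t\<close> of the branch (the point itself, or position \<open>1\<close> if \<open>y\<close> is elsewhere), and its
  distance from a position \<open>s\<close> is the distance from \<open>s\<close> to \<open>t\<close> plus a constant. So one moves along the
  branch until \<open>t\<close> is reached, and then on to the centre.
\<close>
lemma tree_metric_spider:
  assumes "k \<ge> 5"
  shows "tree_metric (spider_verts n k) spider_dist None"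
proof (unfold_locales, goal_cases)
  case 1
  then show ?case by (simp add: spider_verts_def)
next
  case 2
  then show ?case by simp
next
  case (3 x y)
  then show ?case
    by (elim spider_verts_cases) (auto simp: line_dist_def)
next
  case (4 x y)
  then show ?case
    by (elim spider_verts_cases) (auto simp: line_dist_def)
next
  case (5 x y z)
  from 5(4) show ?case
    unfolding spider_dist_eq_1_iff
    by (cases y) (auto simp: line_dist_def)
next
  case (6 x y)
  from 6(1) show ?case
  proof (cases rule: spider_verts_cases)
    case 1
    from 6(2) obtain j t where y: "y = Some (j, t)" "j < n"
      using 1 6(3) by (elim spider_verts_cases) auto
    then show ?thesis
      using 1 assms by (intro bexI[of _ "Some (j, 1)"]) (auto simp: line_dist_def)
  next
    case (2 i s)
    obtain t c where t: "t \<le> k - 2" and c: "\<And>s. spider_dist (Some (i, s)) y = line_dist s t + c"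
      and y: "y = Some (i, t) \<and> c = 0 \<or> t = 1 \<and> spider_dist None y + 1 = c"
    proof (cases "\<exists>t. y = Some (i, t)")
      case True
      then show ?thesis using that[of _ 0] 6(2) by auto
    next
      case False
      show ?thesis
      proof (rule that[of 1 "spider_dist None y + 1"])
        show "spider_dist (Some (i, s)) y = line_dist s 1 + (spider_dist None y + 1)" for s
          using False by (cases "(Some (i, s), y)" rule: spider_dist.cases) auto
      qed (use assms in auto)
    qed
    show ?thesis
    proof (cases "s = t")
      case True
      then have "s = 1" "spider_dist None y + 1 = c" using y 2 6(3) by auto
      then show ?thesis
        using 2 True c[of s] by (intro bexI[of _ None]) (auto simp: line_dist_def)
    next
      case False
      define s' where "s' = (if s < t then s + 1 else s - 1)"
      have "s' \<le> k - 2" "line_dist s s' = 1" "line_dist s' t + 1 = line_dist s t"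
        using False t 2 by (auto simp: s'_def line_dist_def)
      then show ?thesis
        using 2 c[of s] c[of s'] by (intro bexI[of _ "Some (i, s')"]) auto
    qed
  qed
next
  case (7 x y z)
  from 7(4-7) show ?case
    unfolding spider_dist_eq_1_iff
    by (auto simp: line_dist_def)
qed

text \<open>The centre has a neighbour in each of the at least two branches, and positions strictly between
  \<open>0\<close> and \<open>k - 2\<close> have a neighbour on either side.\<close>
lemma spider_leaves:
  assumes "n \<ge> 2" "k \<ge> 5"
  shows "{x \<in> spider_verts n k. \<exists>!y. y \<in> spider_verts n k \<and> spider_dist x y = 1} =
    Some ` ({..<n} \<times> {0, k - 2})"
proof (rule set_eqI)
  fix x
  let ?N = "\<lambda>x y. y \<in> spider_verts n k \<and> spider_dist x y = 1"
  have two: "\<not> (\<exists>!y. ?N x y)" if "?N x a" "?N x b" "a \<noteq> b" for x a b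
    using that by blast
  show "x \<in> {x \<in> spider_verts n k. \<exists>!y. ?N x y} \<longleftrightarrow> x \<in> Some ` ({..<n} \<times> {0, k - 2})"
  proof (cases "x \<in> spider_verts n k")
    case True
    then show ?thesis
    proof (cases rule: spider_verts_cases)
      case 1
      then have "\<not> (\<exists>!y. ?N x y)"
        using assms by (intro two[where x = x and a = "Some (0, 1)" and b = "Some (1, 1)"]) (auto simp: line_dist_def)
      then show ?thesis using 1 by auto
    next
      case (2 i s)
      consider "s = 0" | "s = k - 2" | "0 < s" "s < k - 2" using 2 by linarith
      then show ?thesis
      proof cases
        case 1
        have "\<exists>!y. ?N x y"
        proof (rule ex1I[of _ "Some (i, 1)"])
          show "?N x (Some (i, 1))" using 1 2 assms by (auto simp: line_dist_def)
        next
          fix y assume "?N x y"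
          then show "y = Some (i, 1)"
            using 1 2 by (auto simp: line_dist_def elim!: spider_verts_cases split: if_splits)
        qed
        then show ?thesis using 1 2 by auto
      next
        case s: 2
        have "\<exists>!y. ?N x y"
        proof (rule ex1I[of _ "Some (i, k - 3)"])
          show "?N x (Some (i, k - 3))" using s 2 assms by (auto simp: line_dist_def)
        next
          fix y assume "?N x y"
          then show "y = Some (i, k - 3)"
            using s 2 assms by (auto simp: line_dist_def elim!: spider_verts_cases split: if_splits)
        qed
        then show ?thesis using s 2 by auto
      next
        case 3
        have "\<not> (\<exists>!y. ?N x y)"
          using 2 3 by (intro two[where x = x and a = "Some (i, s - 1)" and b = "Some (i, s + 1)"]) (auto simp: line_dist_def)
        then show ?thesis using 2 3 by auto
      qed
    qed
  next
    case False
    then show ?thesis by auto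
  qed
qed

lemma crown_exact_leaf_power:
  assumes G: "crown_labelling n G u v" and n: "n \<ge> 2" and k: "k \<ge> 5"
  shows "exact_leaf_power k G"
proof -
  let ?L = "Some ` ({..<n} \<times> {0, k - 2})"
  define f where "f x = (case x of Some (i, s) \<Rightarrow> if s = (0::nat) then u i else v i)" for x
  have f_simps [simp]: "f (Some (i, 0)) = u i" "f (Some (i, k - 2)) = v i" for i
    using k by (auto simp: f_def)
  have u: "inj_on u {..<n}" and v: "inj_on v {..<n}" and uv: "u ` {..<n} \<inter> v ` {..<n} = {}"
    and V: "pverts G = u ` {..<n} \<union> v ` {..<n}"
    and E: "\<And>x y. (x, y) \<in> parcs G \<longleftrightarrow>
        (\<exists>i<n. \<exists>j<n. i \<noteq> j \<and> (x = u i \<and> y = v j \<or> x = v j \<and> y = u i))"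
    using G by (auto simp: crown_labelling_def)
  have eqs: "u i = u j \<longleftrightarrow> i = j" "v i = v j \<longleftrightarrow> i = j" "u i \<noteq> v j" "v j \<noteq> u i" if "i < n" "j < n" for i j
  proof -
    show "u i = u j \<longleftrightarrow> i = j" "v i = v j \<longleftrightarrow> i = j"
      using inj_on_eq_iff[OF u, of i j] inj_on_eq_iff[OF v, of i j] that by simp_all
    show "u i \<noteq> v j" "v j \<noteq> u i"
      using uv that by blast+
  qed
  have adj: "(u i, v j) \<in> parcs G \<longleftrightarrow> i \<noteq> j" "(v j, u i) \<in> parcs G \<longleftrightarrow> i \<noteq> j"
    "(u i, u j) \<notin> parcs G" "(v i, v j) \<notin> parcs G" if "i < n" "j < n" for i j
    unfolding E using that by (simp_all add: eqs cong: conj_cong)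
  (* Distinct leaves are at distance k - 2, k, 4 or 2 * (k - 2); here each is compared with k. *)
  have k_eqs: "k - 2 \<noteq> k" "k \<noteq> 0" "2 < k" "4 \<noteq> k" "Suc (Suc (Suc (k - 3))) = k"
    "k - 3 + (k - 3) + 2 \<noteq> k"
    using k by auto
  have L: "?L = (\<lambda>i. Some (i, 0)) ` {..<n} \<union> (\<lambda>i. Some (i, k - 2)) ` {..<n}"
    by auto
  show ?thesis
  proof (rule exact_leaf_powerI[OF tree_metric_spider[OF k, of n] crown_labelling_pair_graph[OF G]
        spider_leaves[OF n k, symmetric]])
    show "bij_betw f ?L (pverts G)"
      unfolding bij_betw_def
    proof
      show "inj_on f ?L"
      proof (rule inj_onI)
        fix x y assume "x \<in> ?L" "y \<in> ?L" "f x = f y"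
        then show "x = y" unfolding L by (elim UnE imageE) (simp_all add: eqs)
      qed
      show "f ` ?L = pverts G" unfolding V L image_Un image_image by simp
    qed
  next
    fix x y assume xy: "x \<in> ?L" "y \<in> ?L" "x \<noteq> y"
    then obtain i s j t where "x = Some (i, s)" "y = Some (j, t)" "i < n" "j < n"
      "s = 0 \<or> s = k - 2" "t = 0 \<or> t = k - 2" by auto
    then show "(f x, f y) \<in> parcs G \<longleftrightarrow> spider_dist x y = k"
      using xy(3) k_eqs by (elim disjE) (simp_all add: adj line_dist_def)
  qed
qed

section \<open>The cube\<close>

text \<open>The side \<open>u\<close> lists the vectors of even weight, and \<open>v i\<close> is the antipode of \<open>u i\<close>.\<close>
lemma hypercube_3_labelling:
  "\<exists>u v. crown_labelling 4 (hypercube 3) u v"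
proof -
  define u where "u = (!) [[False, False, False], [False, True, True], [True, False, True], [True, True, False]]"
  define v where "v i = map Not (u i)" for i
  have sum: "card {i. i < 3 \<and> [a, b, c] ! i \<noteq> [d, e, f] ! i} =
    of_bool (a \<noteq> d) + of_bool (b \<noteq> e) + of_bool (c \<noteq> f)" for a b c d e f :: bool
  proof -
    have "{i. i < 3 \<and> [a, b, c] ! i \<noteq> [d, e, f] ! i} = 
      (if a \<noteq> d then {0} else {}) \<union> (if b \<noteq> e then {1} else {}) \<union> (if c \<noteq> f then {2} else {})"
      by (auto simp: less_Suc_eq numeral_3_eq_3 numeral_2_eq_2)
    then show ?thesis by (auto simp: card_insert_if)
  qed
  have len: "length xs = 3 \<longleftrightarrow> (\<exists>a b c. xs = [a, b, c])" for xs :: "bool list"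
    by (auto simp: length_Suc_conv numeral_3_eq_3)
  have ex4: "(\<exists>i<4. P i) \<longleftrightarrow> P 0 \<or> P 1 \<or> P 2 \<or> P (3::nat)" for P
    by (auto simp: less_Suc_eq numeral_eq_Suc)
  have set4: "{..<4} = {0, 1, 2, 3::nat}" by auto
  have u_simps: "u 0 = [False, False, False]" "u 1 = [False, True, True]"
    "u 2 = [True, False, True]" "u 3 = [True, True, False]"
    by (simp_all add: u_def)
  have "crown_labelling 4 (hypercube 3) u v"
    unfolding crown_labelling_def
  proof (intro conjI allI)
    show "inj_on u {..<4}" "inj_on v {..<4}" "u ` {..<4} \<inter> v ` {..<4} = {}"
      unfolding set4 by (simp_all add: v_def u_simps[simplified] u_simps)
    show "pverts (hypercube 3) = u ` {..<4} \<union> v ` {..<4}"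
      unfolding set4 by (auto simp: hypercube_def len v_def u_simps[simplified] u_simps)
    fix x y :: "bool list"
    show "(x, y) \<in> parcs (hypercube 3) \<longleftrightarrow>
        (\<exists>i<4. \<exists>j<4. i \<noteq> j \<and> (x = u i \<and> y = v j \<or> x = v j \<and> y = u i))"
    proof (cases "length x = 3 \<and> length y = 3")
      case True
      then obtain a b c d e f where xy: "x = [a, b, c]" "y = [d, e, f]" by (auto simp: len)
      have "(x, y) \<in> parcs (hypercube 3) \<longleftrightarrow>
          of_bool (a \<noteq> d) + of_bool (b \<noteq> e) + of_bool (c \<noteq> f) = (1::nat)"
        unfolding hypercube_def xy using sum[of a b c d e f] by simp
      also have "\<dots> \<longleftrightarrow> (\<exists>i<4. \<exists>j<4. i \<noteq> j \<and> (x = u i \<and> y = v j \<or> x = v j \<and> y = u i))"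
        unfolding ex4 xy v_def u_simps
        by (cases a; cases b; cases c; cases d; cases e; cases f; simp)
      finally show ?thesis .
    next
      case False
      then show ?thesis
        unfolding ex4 v_def u_simps by (auto simp: hypercube_def)
    qed
  qed
  then show ?thesis by blast
qed

theorem corollary5p3:
  shows "(\<forall>n k. \<forall>C :: 'a pair_pre_digraph.
            n \<ge> 2 \<and> k \<ge> 5 \<and> crown_graph n C \<longrightarrow> exact_leaf_power k C) \<and>
         (\<forall>C :: 'b pair_pre_digraph.
            crown_graph 4 C \<longrightarrow> digraph_iso (with_proj (hypercube 3)) (with_proj C)) \<and>
         exact_leaf_power 5 (hypercube 3)"
proof (intro conjI allI impI)
  fix n k :: nat and C :: "'a pair_pre_digraph"
  assume "n \<ge> 2 \<and> k \<ge> 5 \<and> crown_graph n C"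
  then show "exact_leaf_power k C"
    using crown_graph_labelling crown_exact_leaf_power by metis
next
  fix C :: "'b pair_pre_digraph"
  assume "crown_graph 4 C"
  then show "digraph_iso (with_proj (hypercube 3)) (with_proj C)"
    using crown_graph_labelling hypercube_3_labelling crown_labelling_iso by metis
next
  show "exact_leaf_power 5 (hypercube 3)"
    using hypercube_3_labelling crown_exact_leaf_power[of 4 "hypercube 3"] by auto
qed

end
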